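(* If for each output dimension $j\in\{1,\dots,m\}$ and some $\lambda\ge0$ we have $$L(n)\ \ge\ \max_{(s,s')\in U_n}\frac{|\tilde f_j(s)-\tilde f_j(s')|-\lambda}{\mathfrak d(s,s')^\alpha},$$ then the LACKI rule is sample-consistent up to $\frac\lambda2$. That is, for all $q\in\{1,\dots,N_n\}$, $\hat f_n(s_q)$ lies in the ball $\{y\in\mathbb R^m:\|y-\tilde f_q\|_\infty\le\frac\lambda2\}$ around the observation $\tilde f_q$. Thus, also $\|f(s_q)-\hat f_n(s_q)\|_\infty\le\frac\lambda2+\|\mathfrak e(s_q)\|_\infty\le\frac\lambda2+\bar{\mathfrak e}$.
   Context: Setting. $\mathcal X$ is an additive abelian group with a translation-invariant pseudo-metric $\mathfrak d$. Outputs lie in $\mathbb R^m$ with metric $\|y-y'\|_\infty$. $f:\mathcal X\to\mathbb R^m$ is the target and $\tilde f:\mathcal X\to\mathbb R^m$ the noise-corrupted observable, with $\|\tilde f(x)-f(x)\|_\infty\le\mathfrak e(x)\le\bar{\mathfrak e}$ for all $x\in\mathcal X$, where $\mathfrak e:\mathcal X\to\mathbb R_{\ge0}$ and $\bar{\mathfrak e}\in\mathbb R_{\ge0}$. $\mathcal D_n=\{(s_i,\tilde f_i):i=1,\dots,N_n\}$ is a finite data set with $s_i\in\mathcal X$, $\tilde f_i=\tilde f(s_i)$; $G_n=\{s_1,\dots,s_{N_n}\}$ and $U_n=\{(s,s')\in G_n\times G_n:\mathfrak d(s,s')>0\}$. LACKI predictor. Parameters: $\alpha\in(0,1]$, $\lambda\ge0$,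 $\underline L\ge0$, a function $e:\mathcal X\to\mathbb R_{\ge0}$, and a priori lower and upper bound functions $\underline B,\bar B:\mathcal X\to(\mathbb R\cup\{-\infty,\infty\})^m$ with $\underline B\le\bar B$ componentwise. For each component $j$, $$\mathfrak u_{n,j}(x)=\min_i\big(\tilde f_{i,j}+L(n)\mathfrak d(x,s_i)^\alpha+e(x)\big),\qquad \mathfrak l_{n,j}(x)=\max_i\big(\tilde f_{i,j}-L(n)\mathfrak d(x,s_i)^\alpha-e(x)\big),$$ $$\hat f_{n,j}(x)=\tfrac12\min\{\bar B_j(x),\mathfrak u_{n,j}(x)\}+\tfrac12\max\{\underline B_j(x),\mathfrak l_{n,j}(x)\}.$$ The LACKI rule chooses $L(n)=\max\{\underline L,\max_{(s,s')\in U_n}(\|\tilde f(s)-\tilde f(s')\|_\infty-\lambda)/\mathfrak d(s,s')^\alpha\}$.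
   Formalization: Two conditions are added, as the claim fails without them: samples at pseudo-distance 0 have observations differing by at most λ in each component, and at every sample the a priori bounds satisfy B̲ ≤ f̃ − e + λ and f̃ + e − λ ≤ B̄ componentwise. *)

theory Defs
  imports "HOL-Analysis.Analysis"
begin

definition translation_invariant_pseudometric :: "('x::ab_group_add \<Rightarrow> 'x \<Rightarrow> real) \<Rightarrow> bool" where
  "translation_invariant_pseudometric d \<longleftrightarrow>
     (\<forall>x y. 0 \<le> d x y) \<and> (\<forall>x. d x x = 0) \<and> (\<forall>x y. d x y = d y x) \<and>
     (\<forall>x y z. d x z \<le> d x y + d y z) \<and> (\<forall>x y z. d (x + z) (y + z) = d x y)"

text \<open>
  A data set of size \<open>N\<close> is given by sample inputs \<open>s 1, \<dots>, s N\<close> and an observable \<open>ft\<close>; the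
  \<open>i\<close>-th observation is \<open>ft (s i)\<close>. Outputs are vectors in \<open>real ^ 'm\<close> with the maximum norm
  \<open>infnorm\<close>.
\<close>

definition sample_grid :: "nat \<Rightarrow> (nat \<Rightarrow> 'x) \<Rightarrow> 'x set" where
  "sample_grid N s = s ` {1..N}"

definition separated_pairs :: "('x \<Rightarrow> 'x \<Rightarrow> real) \<Rightarrow> 'x set \<Rightarrow> ('x \<times> 'x) set" where
  "separated_pairs d G = {(x, x') \<in> G \<times> G. 0 < d x x'}"

definition ceiling_fn ::
  "('x \<Rightarrow> 'x \<Rightarrow> real) \<Rightarrow> real \<Rightarrow> ('x \<Rightarrow> real) \<Rightarrow> real \<Rightarrow> nat \<Rightarrow> (nat \<Rightarrow> 'x) \<Rightarrow> ('x \<Rightarrow> real ^ 'm) \<Rightarrow>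
   'm \<Rightarrow> 'x \<Rightarrow> real" where
  "ceiling_fn d \<alpha> e L N s ft j x =
     Min ((\<lambda>i. ft (s i) $ j + L * d x (s i) powr \<alpha> + e x) ` {1..N})"

definition floor_fn ::
  "('x \<Rightarrow> 'x \<Rightarrow> real) \<Rightarrow> real \<Rightarrow> ('x \<Rightarrow> real) \<Rightarrow> real \<Rightarrow> nat \<Rightarrow> (nat \<Rightarrow> 'x) \<Rightarrow> ('x \<Rightarrow> real ^ 'm) \<Rightarrow>
   'm \<Rightarrow> 'x \<Rightarrow> real" where
  "floor_fn d \<alpha> e L N s ft j x =
     Max ((\<lambda>i. ft (s i) $ j - L * d x (s i) powr \<alpha> - e x) ` {1..N})"

text \<open>
  The a priori bounds may be infinite, so the predictor takes extended real values. The sum below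
  is never of the form \<open>\<infinity> + - \<infinity>\<close> when \<open>Blo x $ j \<le> Bup x $ j\<close>, because the ceiling and the
  floor are finite.
\<close>

definition lacki_predictor ::
  "('x \<Rightarrow> 'x \<Rightarrow> real) \<Rightarrow> real \<Rightarrow> ('x \<Rightarrow> real) \<Rightarrow> ('x \<Rightarrow> ereal ^ 'm) \<Rightarrow> ('x \<Rightarrow> ereal ^ 'm) \<Rightarrow> real \<Rightarrow>
   nat \<Rightarrow> (nat \<Rightarrow> 'x) \<Rightarrow> ('x \<Rightarrow> real ^ 'm) \<Rightarrow> 'x \<Rightarrow> ereal ^ 'm" where
  "lacki_predictor d \<alpha> e Blo Bup L N s ft x =
     (\<chi> j. ereal (1/2) * min (Bup x $ j) (ereal (ceiling_fn d \<alpha> e L N s ft j x))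
         + ereal (1/2) * max (Blo x $ j) (ereal (floor_fn d \<alpha> e L N s ft j x)))"

text \<open>The maximum is just \<open>Lmin\<close> when no two samples have positive distance.\<close>

definition lacki_constant ::
  "('x \<Rightarrow> 'x \<Rightarrow> real) \<Rightarrow> real \<Rightarrow> real \<Rightarrow> real \<Rightarrow> nat \<Rightarrow> (nat \<Rightarrow> 'x) \<Rightarrow> ('x \<Rightarrow> real ^ 'm) \<Rightarrow> real" where
  "lacki_constant d \<alpha> lam Lmin N s ft =
     Max (insert Lmin ((\<lambda>(x, x'). (infnorm (ft x - ft x') - lam) / d x x' powr \<alpha>)
                         ` separated_pairs d (sample_grid N s)))"

text \<open>
  \<open>L\<close> is at least the maximal slope of every component, the maximum over no pairs being \<open>-\<infinity>\<close>.
\<close>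

definition dominates_slopes ::
  "('x \<Rightarrow> 'x \<Rightarrow> real) \<Rightarrow> real \<Rightarrow> real \<Rightarrow> nat \<Rightarrow> (nat \<Rightarrow> 'x) \<Rightarrow> ('x \<Rightarrow> real ^ 'm) \<Rightarrow> real \<Rightarrow> bool" where
  "dominates_slopes d \<alpha> lam N s ft L \<longleftrightarrow>
     (\<forall>j. \<forall>(x, x') \<in> separated_pairs d (sample_grid N s).
        L \<ge> (\<bar>ft x $ j - ft x' $ j\<bar> - lam) / d x x' powr \<alpha>)"

lemma lacki_constant_dominates_slopes:
  "dominates_slopes d \<alpha> lam N s ft (lacki_constant d \<alpha> lam Lmin N s ft)"
proof -
  have fin: "finite (separated_pairs d (sample_grid N s))"
    by (rule finite_subset[of _ "sample_grid N s \<times> sample_grid N s"])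
      (auto simp: separated_pairs_def sample_grid_def)
  have "(\<bar>ft x $ j - ft x' $ j\<bar> - lam) / d x x' powr \<alpha> \<le> lacki_constant d \<alpha> lam Lmin N s ft"
    if "(x, x') \<in> separated_pairs d (sample_grid N s)" for j x x'
  proof -
    have "\<bar>ft x $ j - ft x' $ j\<bar> \<le> infnorm (ft x - ft x')"
      using component_le_infnorm_cart[of "ft x - ft x'" j] by simp
    then have "(\<bar>ft x $ j - ft x' $ j\<bar> - lam) / d x x' powr \<alpha>
                 \<le> (infnorm (ft x - ft x') - lam) / d x x' powr \<alpha>"
      by (intro divide_right_mono) auto
    also have "\<dots> \<le> lacki_constant d \<alpha> lam Lmin N s ft"
      unfolding lacki_constant_def using that fin by (intro Max_ge) (auto intro!: image_eqI)
    finally show ?thesis .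
  qed
  then show ?thesis by (auto simp: dominates_slopes_def)
qed

text \<open>
  Two side conditions on the data that sample-consistency up to \<open>lam/2\<close> requires.

  Samples at distance zero do not occur among the separated pairs, so no choice of \<open>L\<close> constrains
  their observations, yet without a priori bounds the predictor takes the same value at both.
  Their observations must therefore differ by at most \<open>lam\<close>. The condition holds automatically
  when \<open>d\<close> is a metric and \<open>0 \<le> lam\<close>.
\<close>

definition coincident_samples_agree ::
  "('x \<Rightarrow> 'x \<Rightarrow> real) \<Rightarrow> real \<Rightarrow> nat \<Rightarrow> (nat \<Rightarrow> 'x) \<Rightarrow> ('x \<Rightarrow> real ^ 'm) \<Rightarrow> bool" where
  "coincident_samples_agree d lam N s ft \<longleftrightarrow>
     (\<forall>x \<in> sample_grid N s. \<forall>x' \<in> sample_grid N s. d x x' = 0 \<longrightarrow> (\<forall>j. \<bar>ft x $ j - ft x' $ j\<bar> \<le> lam))"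

text \<open>
  Clipping by \<open>Blo\<close> and \<open>Bup\<close> must not move the prediction at a sample away from the observation:
  with a single sample, \<open>Blo = -\<infinity>\<close> and \<open>Bup $ j < ft (s 1) $ j + e (s 1) - lam\<close>, the predictor
  misses the observation by more than \<open>lam/2\<close>. The condition holds for infinite bounds, and
  also if the bounds enclose the observations and \<open>e \<le> lam\<close> at the samples, or if they
  enclose the target and \<open>e\<close> plus the observation error is at most \<open>lam\<close>.
\<close>

definition bounds_admit_data ::
  "('x \<Rightarrow> real) \<Rightarrow> ('x \<Rightarrow> ereal ^ 'm) \<Rightarrow> ('x \<Rightarrow> ereal ^ 'm) \<Rightarrow> real \<Rightarrow> nat \<Rightarrow> (nat \<Rightarrow> 'x) \<Rightarrow>
   ('x \<Rightarrow> real ^ 'm) \<Rightarrow> bool" where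
  "bounds_admit_data e Blo Bup lam N s ft \<longleftrightarrow>
     (\<forall>x \<in> sample_grid N s. \<forall>j. Blo x $ j \<le> ereal (ft x $ j - e x + lam) \<and>
                                 ereal (ft x $ j + e x - lam) \<le> Bup x $ j)"

definition ereal_vec :: "real ^ 'm \<Rightarrow> ereal ^ 'm" where
  "ereal_vec y = (\<chi> j. ereal (y $ j))"

definition sample_consistent_upto ::
  "real \<Rightarrow> nat \<Rightarrow> (nat \<Rightarrow> 'x) \<Rightarrow> ('x \<Rightarrow> real ^ 'm) \<Rightarrow> ('x \<Rightarrow> ereal ^ 'm) \<Rightarrow> bool" where
  "sample_consistent_upto r N s ft F \<longleftrightarrow>
     (\<forall>q \<in> {1..N}. F (s q) \<in> ereal_vec ` {y. infnorm (y - ft (s q)) \<le> r})"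

end

theory Submission
  imports Defs
begin

text \<open>
  Let \<open>x\<close> be a sample and \<open>c\<close> a component of its observation. The sample itself bounds the ceiling
  at \<open>x\<close> by \<open>c + e x\<close> from above and the floor by \<open>c - e x\<close> from below; the slope condition
  on \<open>L\<close> says that no other sample moves either of them by more than \<open>lam\<close> from there. Clipping
  keeps the ceiling in \<open>[c + e x - lam, c + e x]\<close> and the floor in \<open>[c - e x, c - e x + lam]\<close>, and the
  mean of two such numbers lies within \<open>lam / 2\<close> of \<open>c\<close>.
\<close>

text \<open>The error bound \<open>err (s q)\<close> is a real number, yet the final estimate takes
  its maximum norm.\<close>

lemma infnorm_real [simp]: "infnorm (a :: real) = \<bar>a\<bar>"
  by (simp add: infnorm_def)

lemma infnorm_le_cart:
  fixes y :: "real ^ 'm"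
  assumes "\<And>j. \<bar>y $ j\<bar> \<le> r"
  shows "infnorm y \<le> r"
  unfolding infnorm_cart using assms by (intro cSup_least) auto

text \<open>Samples at positive distance form a separated pair, and the slope condition is
  multiplied out. At distance zero the power vanishes, since \<open>0 powr \<alpha> = 0\<close>, and
  only the agreement of coincident samples remains.\<close>

lemma sample_difference_bound:
  fixes ft :: "'x::ab_group_add \<Rightarrow> real ^ 'm"
  assumes "translation_invariant_pseudometric d"
    and "coincident_samples_agree d lam N s ft"
    and "dominates_slopes d \<alpha> lam N s ft L"
    and "x \<in> sample_grid N s" "x' \<in> sample_grid N s"
  shows "\<bar>ft x $ j - ft x' $ j\<bar> \<le> lam + L * d x x' powr \<alpha>"
proof (cases "d x x' = 0")
  case True
  with assms show ?thesis by (simp add: coincident_samples_agree_def)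
next
  case False
  with assms(1) have pos: "0 < d x x'"
    unfolding translation_invariant_pseudometric_def by (metis order_le_less)
  with assms(3-5) have "(\<bar>ft x $ j - ft x' $ j\<bar> - lam) / d x x' powr \<alpha> \<le> L"
    by (auto simp: dominates_slopes_def separated_pairs_def)
  with pos show ?thesis by (simp add: divide_le_eq)
qed

lemma ceiling_floor_fn_bounds_at_sample:
  fixes ft :: "'x::ab_group_add \<Rightarrow> real ^ 'm"
  assumes "translation_invariant_pseudometric d"
    and "coincident_samples_agree d lam N s ft"
    and "dominates_slopes d \<alpha> lam N s ft L"
    and q: "q \<in> {1..N}"
  shows "ceiling_fn d \<alpha> e L N s ft j (s q) \<in> {ft (s q) $ j + e (s q) - lam .. ft (s q) $ j + e (s q)}"
    and "floor_fn d \<alpha> e L N s ft j (s q) \<in> {ft (s q) $ j - e (s q) .. ft (s q) $ j - e (s q) + lam}"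
proof -
  have d0: "d (s q) (s q) = 0"
    using assms(1) by (simp add: translation_invariant_pseudometric_def)
  \<comment> \<open>The first inequality keeps every term of the minimum high enough, the second
    every term of the maximum low enough.\<close>
  have diff: "ft (s q) $ j \<le> ft (s i) $ j + L * d (s q) (s i) powr \<alpha> + lam"
    "ft (s i) $ j \<le> ft (s q) $ j + L * d (s q) (s i) powr \<alpha> + lam"
    if "i \<in> {1..N}" for i
    using sample_difference_bound[OF assms(1-3), of "s q" "s i" j] q that
    by (simp_all add: sample_grid_def abs_le_iff)
  \<comment> \<open>The term of index \<open>q\<close> itself is the witness: by \<open>d0\<close>
    its distance term is zero.\<close>
  have "ceiling_fn d \<alpha> e L N s ft j (s q) \<le> ft (s q) $ j + e (s q)"
    unfolding ceiling_fn_def using q d0 by (intro Min_le) (auto intro!: image_eqI[of _ _ q])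
  moreover have "ft (s q) $ j + e (s q) - lam \<le> ceiling_fn d \<alpha> e L N s ft j (s q)"
    unfolding ceiling_fn_def using q diff(1) by (intro Min.boundedI) (auto simp: algebra_simps)
  ultimately show "ceiling_fn d \<alpha> e L N s ft j (s q)
      \<in> {ft (s q) $ j + e (s q) - lam .. ft (s q) $ j + e (s q)}" by simp
  have "ft (s q) $ j - e (s q) \<le> floor_fn d \<alpha> e L N s ft j (s q)"
    unfolding floor_fn_def using q d0 by (intro Max_ge) (auto intro!: image_eqI[of _ _ q])
  moreover have "floor_fn d \<alpha> e L N s ft j (s q) \<le> ft (s q) $ j - e (s q) + lam"
    unfolding floor_fn_def using q diff(2) by (intro Max.boundedI) (auto simp: algebra_simps)
  ultimately show "floor_fn d \<alpha> e L N s ft j (s q)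
      \<in> {ft (s q) $ j - e (s q) .. ft (s q) $ j - e (s q) + lam}" by simp
qed

text \<open>The minimum lies between \<open>a\<close> and \<open>u\<close>, which also makes it
  finite: \<open>B = -\<infinity>\<close> is excluded by \<open>ereal a \<le> B\<close>, and for
  \<open>B = \<infinity>\<close> the minimum is \<open>u\<close>.\<close>

lemma min_ereal_in_Icc:
  assumes "u \<in> {a..b}" "ereal a \<le> B"
  obtains v where "min B (ereal u) = ereal v" "v \<in> {a..b}"
  using assms by (cases B; cases "B \<le> ereal u") (auto simp: min_def)

lemma max_ereal_in_Icc:
  assumes "u \<in> {a..b}" "B \<le> ereal b"
  obtains v where "max B (ereal u) = ereal v" "v \<in> {a..b}"
  using assms by (cases B; cases "B \<le> ereal u") (auto simp: max_def)

text \<open>Both clipped envelopes are finite at a sample, so each component of the extended-real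
  prediction is a real number, and these numbers assemble into \<open>y\<close>.\<close>

lemma lacki_predictor_at_sample:
  fixes ft :: "'x::ab_group_add \<Rightarrow> real ^ 'm"
  assumes "translation_invariant_pseudometric d"
    and "coincident_samples_agree d lam N s ft"
    and "bounds_admit_data e Blo Bup lam N s ft"
    and "dominates_slopes d \<alpha> lam N s ft L"
    and q: "q \<in> {1..N}"
  obtains y where "lacki_predictor d \<alpha> e Blo Bup L N s ft (s q) = ereal_vec y"
    and "infnorm (y - ft (s q)) \<le> lam / 2"
proof -
  let ?F = "lacki_predictor d \<alpha> e Blo Bup L N s ft (s q)"
  have "\<exists>r. ?F $ j = ereal r \<and> \<bar>r - ft (s q) $ j\<bar> \<le> lam / 2" for j
  proof -
    have B: "Blo (s q) $ j \<le> ereal (ft (s q) $ j - e (s q) + lam)"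
      "ereal (ft (s q) $ j + e (s q) - lam) \<le> Bup (s q) $ j"
      using assms(3) q by (auto simp: bounds_admit_data_def sample_grid_def)
    note bounds = ceiling_floor_fn_bounds_at_sample[OF assms(1,2,4) q, of e j]
    obtain u where u: "min (Bup (s q) $ j) (ereal (ceiling_fn d \<alpha> e L N s ft j (s q))) = ereal u"
      "u \<in> {ft (s q) $ j + e (s q) - lam .. ft (s q) $ j + e (s q)}"
      using min_ereal_in_Icc[OF bounds(1) B(2)] .
    obtain l where l: "max (Blo (s q) $ j) (ereal (floor_fn d \<alpha> e L N s ft j (s q))) = ereal l"
      "l \<in> {ft (s q) $ j - e (s q) .. ft (s q) $ j - e (s q) + lam}"
      using max_ereal_in_Icc[OF bounds(2) B(1)] .
    have "?F $ j = ereal (u / 2 + l / 2)"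
      by (simp add: lacki_predictor_def u(1) l(1))
    \<comment> \<open>Adding the two intervals cancels \<open>e (s q)\<close>: the sum
      \<open>u + l\<close> is within \<open>lam\<close> of \<open>2 * ft (s q) $ j\<close>.\<close>
    moreover have "\<bar>u / 2 + l / 2 - ft (s q) $ j\<bar> \<le> lam / 2"
      using u(2) l(2) by (simp add: abs_le_iff field_simps)
    ultimately show ?thesis by blast
  qed
  then obtain r where "\<And>j. ?F $ j = ereal (r j) \<and> \<bar>r j - ft (s q) $ j\<bar> \<le> lam / 2"
    by metis
  then show thesis
    by (intro that[of "\<chi> j. r j"] infnorm_le_cart) (simp_all add: ereal_vec_def vec_eq_iff)
qed

text \<open>Makes the real vector that represents a prediction unique, so that a bound for one
  representative holds for any given one.\<close>

lemma inj_ereal_vec: "inj ereal_vec"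
  by (rule injI) (simp add: ereal_vec_def vec_eq_iff)

theorem lemma2p7:
  fixes d :: "'x::ab_group_add \<Rightarrow> 'x \<Rightarrow> real"
    and f ft :: "'x \<Rightarrow> real ^ 'm"
    and err e :: "'x \<Rightarrow> real"
    and ebar \<alpha> lam L :: real
    and N :: nat and s :: "nat \<Rightarrow> 'x"
    and Blo Bup :: "'x \<Rightarrow> ereal ^ 'm"
  assumes "translation_invariant_pseudometric d"
    and "\<And>x. 0 \<le> err x" and "0 \<le> ebar"
    and "\<And>x. infnorm (ft x - f x) \<le> err x" and "\<And>x. err x \<le> ebar"
    and "0 < \<alpha>" and "\<alpha> \<le> 1" and "0 \<le> lam"
    and "\<And>x. 0 \<le> e x"
    and "\<And>x j. Blo x $ j \<le> Bup x $ j"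
    and "coincident_samples_agree d lam N s ft"
    and "bounds_admit_data e Blo Bup lam N s ft"
    and "dominates_slopes d \<alpha> lam N s ft L"
  shows "sample_consistent_upto (lam / 2) N s ft (lacki_predictor d \<alpha> e Blo Bup L N s ft) \<and>
         (\<forall>q \<in> {1..N}. \<forall>y. lacki_predictor d \<alpha> e Blo Bup L N s ft (s q) = ereal_vec y \<longrightarrow>
            infnorm (f (s q) - y) \<le> lam / 2 + infnorm (err (s q)) \<and>
            lam / 2 + infnorm (err (s q)) \<le> lam / 2 + ebar)"
proof (intro conjI ballI allI impI)
  note at_sample = lacki_predictor_at_sample[OF assms(1,11,12,13)]
  show "sample_consistent_upto (lam / 2) N s ft (lacki_predictor d \<alpha> e Blo Bup L N s ft)"
    unfolding sample_consistent_upto_def by (metis (mono_tags, lifting) at_sample imageI mem_Collect_eq)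
  fix q y
  assume q: "q \<in> {1..N}" and "lacki_predictor d \<alpha> e Blo Bup L N s ft (s q) = ereal_vec y"
  then have "infnorm (y - ft (s q)) \<le> lam / 2"
    using at_sample[OF q] by (metis inj_ereal_vec injD)
  moreover have "infnorm (f (s q) - y) \<le> infnorm (f (s q) - ft (s q)) + infnorm (ft (s q) - y)"
    using infnorm_triangle[of "f (s q) - ft (s q)" "ft (s q) - y"] by simp
  \<comment> \<open>Both distances are used with their arguments swapped, and
    \<open>err (s q)\<close> equals its norm because it is nonnegative.\<close>
  ultimately show "infnorm (f (s q) - y) \<le> lam / 2 + infnorm (err (s q))"
    using assms(2,4)[of "s q"] by (simp add: infnorm_sub)
  show "lam / 2 + infnorm (err (s q)) \<le> lam / 2 + ebar"
    using assms(2,5)[of "s q"] by simp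
qed

end
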